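(* Let $m_1,m_2$ be positive integers. For every point $(x_1,x_2)\in\mathcal{S}^2$, the step length $k(x_1,x_2)$ equals $2\,\mathrm{lcm}(m_1,m_2)$; in particular it does not depend on $(x_1,x_2)$.
   Context: $\mathcal{S}^2=\{(x_1,x_2)\in\mathbb{Z}^2: 0\le x_i\le m_i,\ i=1,2\}$. For a positive integer $m$ let $\varphi_m(u)=\min_{n\in\mathbb{Z}}|u-2nm|$ for $u\in\mathbb{Z}$ (the $2m$-periodic triangle wave with $\varphi_m(u)=u$ for $0\le u\le m$). For $k\in\mathbb{Z}$ put $f_i^k(x)=\varphi_{m_i}(x+k)$ and $F^k(x_1,x_2)=(f_1^k(x_1),f_2^k(x_2))$ (the position after $k$ steps of a light beam started at $(x_1,x_2)$ in direction $(+1,+1)$ reflecting in the boundary of $[0,m_1]\times[0,m_2]$); in particular $F^{-1}(x_1,x_2)=(\varphi_{m_1}(x_1-1),\varphi_{m_2}(x_2-1))$. The step length $k(x_1,x_2)$ is the smallest positive integer $k$ such that $F^{k}(x_1,x_2)=(x_1,x_2)$ and $F^{k-1}(x_1,x_2)=F^{-1}(x_1,x_2)$ (the closed path starting from $(x_1,x_2)$ is the chain $F^1,\dots,F^{k}$). *)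

theory Defs
  imports Complex_Main
begin

definition lattice_rect :: "nat \<Rightarrow> nat \<Rightarrow> (int \<times> int) set" where
  "lattice_rect m1 m2 = {(x1, x2). 0 \<le> x1 \<and> x1 \<le> int m1 \<and> 0 \<le> x2 \<and> x2 \<le> int m2}"

definition tri_wave :: "nat \<Rightarrow> int \<Rightarrow> int" where
  "tri_wave m u = (LEAST v. \<exists>n::int. v = \<bar>u - 2 * n * int m\<bar>)"

definition beam_coord :: "nat \<Rightarrow> int \<Rightarrow> int \<Rightarrow> int" where
  "beam_coord m k x = tri_wave m (x + k)"

definition beam :: "nat \<Rightarrow> nat \<Rightarrow> int \<Rightarrow> int \<times> int \<Rightarrow> int \<times> int" where
  "beam m1 m2 k p = (beam_coord m1 k (fst p), beam_coord m2 k (snd p))"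

definition beam_closes :: "nat \<Rightarrow> nat \<Rightarrow> int \<times> int \<Rightarrow> nat \<Rightarrow> bool" where
  "beam_closes m1 m2 p k \<longleftrightarrow>
     beam m1 m2 (int k) p = p \<and> beam m1 m2 (int k - 1) p = beam m1 m2 (- 1) p"

definition step_length :: "nat \<Rightarrow> nat \<Rightarrow> int \<times> int \<Rightarrow> nat" where
  "step_length m1 m2 p = (LEAST k. 0 < k \<and> beam_closes m1 m2 p k)"

text \<open>The following facts show that the \<open>LEAST\<close> operators above denote genuine minima.\<close>

lemma tri_wave_attained: "\<exists>n::int. tri_wave m u = \<bar>u - 2 * n * int m\<bar>"
  and tri_wave_le: "tri_wave m u \<le> \<bar>u - 2 * n * int m\<bar>"
proof -
  define f where "f n = \<bar>u - 2 * n * int m\<bar>" for n :: int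
  obtain n0 where n0: "\<And>n. nat (f n0) \<le> nat (f n)"
    using ex_has_least_nat[of "\<lambda>_. True" 0 "\<lambda>n. nat (f n)"] by auto
  have le: "f n0 \<le> f n" for n
    using n0[of n] by (simp add: f_def nat_le_eq_zle)
  have eq: "tri_wave m u = f n0"
    unfolding tri_wave_def by (rule Least_equality) (use le in \<open>auto simp: f_def\<close>)
  show "\<exists>n::int. tri_wave m u = \<bar>u - 2 * n * int m\<bar>"
    using eq by (auto simp: f_def)
  show "tri_wave m u \<le> \<bar>u - 2 * n * int m\<bar>"
    using eq le[of n] by (simp add: f_def)
qed

lemma tri_wave_periodic: "tri_wave m (u + 2 * j * int m) = tri_wave m u"
proof (rule antisym)
  obtain n where "tri_wave m u = \<bar>u - 2 * n * int m\<bar>"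
    using tri_wave_attained by blast
  then show "tri_wave m (u + 2 * j * int m) \<le> tri_wave m u"
    using tri_wave_le[of m "u + 2 * j * int m" "n + j"] by (simp add: algebra_simps)
  obtain n where "tri_wave m (u + 2 * j * int m) = \<bar>u + 2 * j * int m - 2 * n * int m\<bar>"
    using tri_wave_attained by blast
  then show "tri_wave m u \<le> tri_wave m (u + 2 * j * int m)"
    using tri_wave_le[of m u "n - j"] by (simp add: algebra_simps)
qed

lemma tri_wave_id:
  assumes "0 \<le> u" "u \<le> int m"
  shows "tri_wave m u = u"
proof (rule antisym)
  show "tri_wave m u \<le> u"
    using tri_wave_le[of m u 0] assms by simp
  obtain n where n: "tri_wave m u = \<bar>u - 2 * n * int m\<bar>"
    using tri_wave_attained by blast
  consider "n \<le> 0" | "n \<ge> 1" by linarith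
  then show "u \<le> tri_wave m u"
  proof cases
    case 1
    then have "n * int m \<le> 0" by (simp add: mult_nonpos_nonneg)
    then show ?thesis using n assms by linarith
  next
    case 2
    then have "int m \<le> n * int m" using mult_right_mono[of 1 n "int m"] by simp
    then show ?thesis using n assms by linarith
  qed
qed

lemma step_length_exists:
  assumes "0 < m1" "0 < m2" "p \<in> lattice_rect m1 m2"
  shows "\<exists>k>0. beam_closes m1 m2 p k"
proof (intro exI conjI)
  show "0 < 2 * m1 * m2" using assms by simp
  have *: "tri_wave m1 (u + int (2 * m1 * m2)) = tri_wave m1 u"
    "tri_wave m2 (u + int (2 * m1 * m2)) = tri_wave m2 u" for u
    using tri_wave_periodic[of m1 u "int m2"] tri_wave_periodic[of m2 u "int m1"]
    by (simp_all add: algebra_simps)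
  show "beam_closes m1 m2 p (2 * m1 * m2)"
    using assms(3) *[of "fst p"] *[of "fst p - 1"] *[of "snd p"] *[of "snd p - 1"]
    by (auto simp: beam_closes_def beam_def beam_coord_def lattice_rect_def tri_wave_id
        algebra_simps)
qed

end

theory Submission
  imports Defs
begin

text \<open>
  Equal values of the wave at \<open>u\<close> and \<open>v\<close> force \<open>u \<equiv> \<plusminus>v\<close> modulo \<open>2m\<close>. If a coordinate repeats both
  its position and its predecessor after \<open>k\<close> steps without \<open>2m\<close> dividing \<open>k\<close>, both congruences carry
  the minus sign, and their difference gives that \<open>2m\<close> divides \<open>2\<close>; so \<open>m = 1\<close>, where the signs
  coincide and \<open>2m\<close> divides \<open>k\<close> after all. Hence the closing times are exactly the common multiples
  of \<open>2m\<^sub>1\<close> and \<open>2m\<^sub>2\<close>.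
\<close>

text \<open>The minimum defining the wave is attained at \<open>u\<close> and at \<open>v\<close>,
  so equal values are equal absolute values, whose arguments agree up to sign.\<close>

lemma tri_wave_eqD:
  assumes "tri_wave m u = tri_wave m v"
  shows "2 * int m dvd u - v \<or> 2 * int m dvd u + v"
proof -
  obtain a where a: "tri_wave m u = \<bar>u - 2 * a * int m\<bar>"
    using tri_wave_attained by blast
  obtain b where b: "tri_wave m v = \<bar>v - 2 * b * int m\<bar>"
    using tri_wave_attained by blast
  have "u - 2 * a * int m = v - 2 * b * int m \<or> u - 2 * a * int m = - (v - 2 * b * int m)"
    using assms a b by (simp add: abs_eq_iff)
  then have "u - v = 2 * int m * (a - b) \<or> u + v = 2 * int m * (a + b)"
    by (auto simp: algebra_simps)
  then show ?thesis by (metis dvd_triv_left)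
qed

lemma beam_coord_closes_iff:
  assumes "0 \<le> x" "x \<le> int m"
  shows "beam_coord m k x = x \<and> beam_coord m (k - 1) x = beam_coord m (- 1) x
    \<longleftrightarrow> 2 * int m dvd k"
proof
  assume "beam_coord m k x = x \<and> beam_coord m (k - 1) x = beam_coord m (- 1) x"
  then have "tri_wave m (x + k) = tri_wave m x" "tri_wave m (x + (k - 1)) = tri_wave m (x - 1)"
    using assms by (simp_all add: beam_coord_def tri_wave_id)
  \<comment> \<open>Both pairs of arguments differ by \<open>k\<close>; their sums are
    \<open>2 * x + k\<close> and \<open>2 * x + k - 2\<close>.\<close>
  from this[THEN tri_wave_eqD]
  have *: "2 * int m dvd k \<or> 2 * int m dvd 2 * x + k"
    "2 * int m dvd k \<or> 2 * int m dvd 2 * x + k - 2"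
    by (simp_all add: algebra_simps)
  show "2 * int m dvd k"
  proof (rule ccontr)
    assume "\<not> 2 * int m dvd k"
    with * have plus: "2 * int m dvd 2 * x + k" and "2 * int m dvd 2 * x + k - 2"
      by simp_all
    from dvd_diff[OF this] have "2 * int m dvd 2 * 1" by simp
    then have "m = 1" by (simp only: dvd_mult_cancel_left) simp
    \<comment> \<open>For \<open>m = 1\<close> the modulus is 2, so \<open>2 * x\<close> drops out
      of \<open>plus\<close>.\<close>
    with plus \<open>\<not> 2 * int m dvd k\<close> show False by simp
  qed
next
  assume "2 * int m dvd k"
  then obtain j where j: "k = 2 * j * int m"
    by (auto simp: dvd_def ac_simps)
  show "beam_coord m k x = x \<and> beam_coord m (k - 1) x = beam_coord m (- 1) x"
    using assms tri_wave_periodic[of m x j] tri_wave_periodic[of m "x - 1" j]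
    by (simp add: beam_coord_def j tri_wave_id algebra_simps)
qed

lemma beam_closes_iff:
  assumes "p \<in> lattice_rect m1 m2"
  shows "beam_closes m1 m2 p k \<longleftrightarrow> 2 * lcm m1 m2 dvd k"
proof -
  have "beam_closes m1 m2 p k \<longleftrightarrow> 2 * int m1 dvd int k \<and> 2 * int m2 dvd int k"
    using assms beam_coord_closes_iff[of "fst p" m1 "int k"]
      beam_coord_closes_iff[of "snd p" m2 "int k"]
    by (auto simp: beam_closes_def beam_def lattice_rect_def)
  also have "\<dots> \<longleftrightarrow> 2 * m1 dvd k \<and> 2 * m2 dvd k"
    by (metis int_dvd_int_iff of_nat_mult of_nat_numeral)
  also have "\<dots> \<longleftrightarrow> lcm (2 * m1) (2 * m2) dvd k"
    by (rule lcm_least_iff[symmetric])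
  also have "lcm (2 * m1) (2 * m2) = 2 * lcm m1 m2"
    by (simp add: lcm_mult_left)
  finally show ?thesis .
qed

theorem theorem3p10:
  fixes m1 m2 :: nat
  assumes "0 < m1" and "0 < m2"
  shows "(\<forall>p \<in> lattice_rect m1 m2. step_length m1 m2 p = 2 * lcm m1 m2) \<and>
         (\<forall>p \<in> lattice_rect m1 m2. \<forall>q \<in> lattice_rect m1 m2.
            step_length m1 m2 p = step_length m1 m2 q)"
proof -
  have "step_length m1 m2 p = 2 * lcm m1 m2" if "p \<in> lattice_rect m1 m2" for p
    \<comment> \<open>The least positive multiple of a positive number is that number.\<close>
    unfolding step_length_def beam_closes_iff[OF that]
    by (rule Least_equality) (use assms in \<open>auto simp: lcm_pos_nat dest: dvd_imp_le\<close>)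
  then show ?thesis by simp
qed

end
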